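(* Let $p\ge2$ be an integer and consider on $\mathbb{R}^{p+2}$, with coordinates $(x,y,t_1,\dots,t_p)$, the vector fields $$X=\partial_x,\qquad Y=\partial_y+\sum_{k=1}^p\frac{x^k}{k!}\,\partial_{t_k}.$$ Consider a horizontal left-invariant vector field $Z=uX+vY$, with $(u,v)\in\mathbb{R}^2$. Then there is $q\in\mathbb{N}$ such that the differential $$d\Gamma^{(q)}\big((u,v),(u,v),\dots,(u,v)\big):(\mathbb{R}^2)^q\to\mathbb{R}^{p+2}$$ of the $q$-th multiexponential map $\Gamma^{(q)}$ at the point $((u,v),\dots,(u,v))\in(\mathbb{R}^2)^q$ is onto if and only if $u\ne0$.
   Context: $\mathbb{R}^{p+2}$ is equipped with the filiform Carnot group (of the first type, of step $p+1$) law $$(x,y,t)\cdot(\xi,\eta,\tau)=\Big(x+\xi,\;y+\eta,\;t_1+\tau_1+x\eta,\;\dots,\;t_k+\tau_k+\frac{x^k}{k!}\eta+\sum_{j=1}^{k-1}\frac{x^{k-j}}{(k-j)!}\tau_j,\;\dots\Big),\quad k=2,\dots,p,$$ for which $X,Y$ are left-invariant and span the first (horizontal) layer $V_1$ of the Lie algebra. The map $\exp$ is the Lie group exponential: $\exp(Z)$ is the value at time $1$ of the integral curve of $Z$ starting at $0$. For $q\in\mathbb{N}$ (a positive integer) the $q$-th multiexponential map is $\Gamma^{(q)}:(\mathbb{R}^2)^q\to\mathbb{R}^{p+2}$, $$\Gamma^{(q)}(w_1,\dots,w_q)=\exp(u_1X+v_1Y)\cdot\exp(u_2X+v_2Y)\cdots\exp(u_qX+v_qY),\qquad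 w_k=(u_k,v_k)\in\mathbb{R}^2.$$ *)

theory Defs
  imports "HOL-Analysis.Analysis"
begin

text \<open>
  Points \<open>(x, y, t)\<close> of \<open>\<real>\<^sup>p\<^sup>+\<^sup>2\<close>, where \<open>p = CARD('p)\<close>. The coordinates \<open>t\<^sub>1, \<dots>, t\<^sub>p\<close> are
  indexed by the finite linearly ordered type \<open>'p\<close>: the \<open>k\<close>-th smallest element \<open>i\<close> of \<open>'p\<close>,
  i.e. the one with \<open>idx i = k\<close>, stands for the index \<open>k \<in> {1..p}\<close>.
\<close>

type_synonym 'p filiform = "real \<times> real \<times> (real ^ 'p)"

definition idx :: "'p::{finite,linorder} \<Rightarrow> nat"
  where "idx i = card {..i}"

definition X_field :: "'p::{finite,linorder} filiform \<Rightarrow> 'p filiform"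
  where "X_field = (\<lambda>(x, y, t). (1, 0, 0))"

definition Y_field :: "'p::{finite,linorder} filiform \<Rightarrow> 'p filiform"
  where "Y_field = (\<lambda>(x, y, t). (0, 1, \<chi> i. x ^ idx i / fact (idx i)))"

definition filiform_mult ::
    "'p::{finite,linorder} filiform \<Rightarrow> 'p filiform \<Rightarrow> 'p filiform"  (infixl "\<odot>" 70)
  where "filiform_mult = (\<lambda>(x, y, t) (\<xi>, \<eta>, \<tau>).
    (x + \<xi>, y + \<eta>,
     \<chi> i. t $ i + \<tau> $ i + x ^ idx i / fact (idx i) * \<eta>
          + (\<Sum>j\<in>{..<i}. x ^ (idx i - idx j) / fact (idx i - idx j) * \<tau> $ j)))"

definition integral_curve :: "('a::real_normed_vector \<Rightarrow> 'a) \<Rightarrow> (real \<Rightarrow> 'a) \<Rightarrow> bool"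
  where "integral_curve Z \<gamma> \<longleftrightarrow> (\<forall>s. (\<gamma> has_vector_derivative Z (\<gamma> s)) (at s))"

definition lie_exp :: "('a::real_normed_vector \<Rightarrow> 'a) \<Rightarrow> 'a"
  where "lie_exp Z = (THE g. \<exists>\<gamma>. integral_curve Z \<gamma> \<and> \<gamma> 0 = 0 \<and> \<gamma> 1 = g)"

definition horizontal :: "real \<times> real \<Rightarrow> 'p::{finite,linorder} filiform \<Rightarrow> 'p filiform"
  where "horizontal w = (\<lambda>g. fst w *\<^sub>R X_field g + snd w *\<^sub>R Y_field g)"

text \<open>
  The \<open>q\<close>-th multiexponential map. The factors are numbered from \<open>0\<close>, so \<open>w i\<close> is the pair
  \<open>w\<^sub>i\<^sub>+\<^sub>1\<close> of the usual notation; the product starts from the group identity \<open>0\<close>.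
\<close>

primrec multiexp :: "nat \<Rightarrow> (nat \<Rightarrow> real \<times> real) \<Rightarrow> 'p::{finite,linorder} filiform"
  where
    "multiexp 0 w = 0"
  | "multiexp (Suc q) w = multiexp q w \<odot> lie_exp (horizontal (w q))"

lemma filiform_mult_0_left: "0 \<odot> g = g"
proof -
  have "idx i \<noteq> 0" for i :: 'a
    by (auto simp: idx_def card_gt_0_iff)
  moreover have "\<not> idx i \<le> idx j" if "j < i" for i j :: 'a
    using that unfolding idx_def not_le by (intro psubset_card_mono) auto
  ultimately show ?thesis
    by (cases g) (auto simp: filiform_mult_def zero_prod_def vec_eq_iff power_0_left intro!: sum.neutral)
qed

text \<open>
  The length \<open>q\<close> has to vary inside a formula, so the space \<open>E\<^sup>q\<close> (with \<open>E = \<real>\<^sup>2\<close> in the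
  application) is not a type: it is rendered as the set of sequences vanishing from position
  \<open>q\<close> on, with pointwise operations and the Euclidean norm. The last conjunct of
  \<open>has_differential\<close> is Frechet differentiability, as in \<open>has_derivative\<close>; boundedness of the
  linear map is automatic in finite dimension. Only the values of \<open>L\<close> on \<open>tuples q\<close> matter.
\<close>

definition tuples :: "nat \<Rightarrow> (nat \<Rightarrow> 'e::euclidean_space) set"
  where "tuples q = {h. \<forall>i\<ge>q. h i = 0}"

definition tuple_norm :: "nat \<Rightarrow> (nat \<Rightarrow> 'e::euclidean_space) \<Rightarrow> real"
  where "tuple_norm q h = L2_set (\<lambda>i. norm (h i)) {..<q}"

definition has_differential ::
    "nat \<Rightarrow> ((nat \<Rightarrow> 'e::euclidean_space) \<Rightarrow> 'b::real_normed_vector)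
      \<Rightarrow> ((nat \<Rightarrow> 'e) \<Rightarrow> 'b) \<Rightarrow> (nat \<Rightarrow> 'e) \<Rightarrow> bool"
  where "has_differential q F L w \<longleftrightarrow>
    (\<forall>h\<in>tuples q. \<forall>k\<in>tuples q. L (\<lambda>i. h i + k i) = L h + L k) \<and>
    (\<forall>c. \<forall>h\<in>tuples q. L (\<lambda>i. c *\<^sub>R h i) = c *\<^sub>R L h) \<and>
    (\<forall>e>0. \<exists>d>0. \<forall>h\<in>tuples q. tuple_norm q h < d \<longrightarrow>
       norm (F (\<lambda>i. w i + h i) - F w - L h) \<le> e * tuple_norm q h)"

definition diagonal_tuple :: "nat \<Rightarrow> 'e::euclidean_space \<Rightarrow> nat \<Rightarrow> 'e"
  where "diagonal_tuple q a = (\<lambda>i. if i < q then a else 0)"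

end

theory Submission
  imports Defs "HOL-Computational_Algebra.Polynomial"
begin

text \<open>
  By left invariance, right multiplication by \<open>exp(uX + vY)\<close> is the time-one flow of
  \<open>uX + vY\<close>. So the multiexponential map is the endpoint of the horizontal lift of a polygonal
  path in the \<open>(x, y)\<close>-plane, and its \<open>t\<^sub>k\<close>-component is the sum, over the edges of the path, of
  \<open>v\<^sub>m\<close> times the mean of \<open>z\<^sup>k / k!\<close> on the \<open>x\<close>-interval that the edge traverses
  (\<open>multiexp_closed_form\<close>). Everything is read off from this polynomial formula. A differential
  exists at every point, so only its values on suitable directions matter, and these are
  derivatives along lines.

  Let \<open>u = 0\<close>. Along a line through the diagonal point all abscissae are proportional to the
  parameter \<open>s\<close>, so \<open>t\<^sub>k\<close> is \<open>s\<^sup>k\<close> times a polynomial in \<open>s\<close>. For \<open>k \<ge> 2\<close>, and such a \<open>k\<close> exists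
  because \<open>p \<ge> 2\<close>, its derivative vanishes in every direction
  (\<open>multiexp_not_submersive_at_vertical\<close>).

  Let \<open>u \<noteq> 0\<close> and \<open>q = p + 1\<close>. The map is affine in the \<open>v\<^sub>j\<close>, and its derivative in the
  direction of \<open>v\<^sub>j\<close>, with \<open>j\<close> counted from \<open>0\<close>, consists of the means of \<open>1, z, \<dots>, z\<^sup>p / p!\<close> on
  the interval between \<open>j u\<close> and \<open>(j + 1) u\<close>. A linear relation satisfied by these \<open>p + 1\<close> vectors
  says that a primitive \<open>P\<close> of some polynomial of degree at most \<open>p\<close> takes the same value at all
  the \<open>p + 2\<close> points \<open>0, u, \<dots>, (p + 1) u\<close>. Normalised by \<open>P 0 = 0\<close>, it has more roots than a
  nonzero polynomial of its degree can have, so the relation is trivial (\<open>segment_mean_independent\<close>). Hence these vectors span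
  the directions \<open>(y, t)\<close>, and any direction that moves \<open>x\<close> completes them to a spanning set.
\<close>

section \<open>The index type as an initial segment of the natural numbers\<close>

lemma strict_mono_idx: "strict_mono (idx :: 'p::{finite,linorder} \<Rightarrow> nat)"
  unfolding strict_mono_def idx_def by (auto intro!: psubset_card_mono)

lemma inj_on_idx: "inj_on (idx :: 'p::{finite,linorder} \<Rightarrow> nat) A"
  using strict_mono_imp_inj_on[OF strict_mono_idx] by (rule inj_on_subset) (rule subset_UNIV)

lemma idx_pos: "0 < idx (i :: 'p::{finite,linorder})"
  by (auto simp: idx_def card_gt_0_iff)

lemma idx_le_CARD: "idx (i :: 'p::{finite,linorder}) \<le> CARD('p)"
  unfolding idx_def by (intro card_mono) auto

lemma idx_image_lessThan: "idx ` {..<i} = {1..<idx (i :: 'p::{finite,linorder})}"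
proof (rule card_subset_eq)
  show "idx ` {..<i} \<subseteq> {1..<idx i}"
    using idx_pos by (auto simp: Suc_le_eq strict_mono_less[OF strict_mono_idx])
  have "{..i} = insert i {..<i}"
    by auto
  then have "idx i = Suc (card {..<i})"
    by (simp add: idx_def)
  then show "card (idx ` {..<i}) = card {1..<idx i}"
    by (simp add: card_image inj_on_idx)
qed simp

section \<open>Means of monomials over segments\<close>

text \<open>
  The mean of \<open>z\<^sup>k / k!\<close> over the segment from \<open>x\<close> to \<open>x + u\<close>, that is the integral of
  \<open>(x + s u)\<^sup>k / k!\<close> over \<open>0 \<le> s \<le> 1\<close>, expanded in powers of \<open>u\<close>. In this form it makes sense for
  \<open>u = 0\<close>, and its summands are those of the group law.
\<close>

definition segment_mean :: "nat \<Rightarrow> real \<Rightarrow> real \<Rightarrow> real"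
  where "segment_mean k x u = (\<Sum>j\<le>k. x ^ (k - j) * u ^ j / (fact (k - j) * fact (Suc j)))"

text \<open>
  Length times mean is the increment of the primitive \<open>z\<^sup>k\<^sup>+\<^sup>1 / (k+1)!\<close>, so over consecutive
  segments these products telescope.
\<close>

lemma segment_mean_telescope:
  "u * segment_mean k x u = ((x + u) ^ Suc k - x ^ Suc k) / fact (Suc k)"
proof -
  have "(x + u) ^ Suc k = (\<Sum>i\<le>Suc k. of_nat (Suc k choose i) * u ^ i * x ^ (Suc k - i))"
    using binomial_ring[of u x "Suc k"] by (simp add: add.commute)
  also have "\<dots> = x ^ Suc k + (\<Sum>j\<le>k. of_nat (Suc k choose Suc j) * u ^ Suc j * x ^ (k - j))"
    by (subst sum.atMost_Suc_shift) simp
  finally have "((x + u) ^ Suc k - x ^ Suc k) / fact (Suc k)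
      = (\<Sum>j\<le>k. of_nat (Suc k choose Suc j) * u ^ Suc j * x ^ (k - j) / fact (Suc k))"
    by (simp only: add_diff_cancel_left' sum_divide_distrib)
  also have "\<dots> = (\<Sum>j\<le>k. u * (x ^ (k - j) * u ^ j / (fact (k - j) * fact (Suc j))))"
  proof (rule sum.cong)
    fix j assume "j \<in> {..k}"
    then have "real (Suc k choose Suc j) = fact (Suc k) / (fact (Suc j) * fact (k - j))"
      using binomial_fact[of "Suc j" "Suc k"] by (simp del: fact_Suc binomial_Suc_Suc)
    then show "of_nat (Suc k choose Suc j) * u ^ Suc j * x ^ (k - j) / fact (Suc k)
        = u * (x ^ (k - j) * u ^ j / (fact (k - j) * fact (Suc j)))"
      by (simp add: field_simps del: fact_Suc binomial_Suc_Suc)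
  qed simp
  finally show ?thesis
    by (simp add: segment_mean_def sum_distrib_left)
qed

lemma segment_mean_scale: "segment_mean k (s * x) (s * u) = s ^ k * segment_mean k x u"
  unfolding segment_mean_def sum_distrib_left
proof (rule sum.cong)
  fix j assume "j \<in> {..k}"
  then have "s ^ k = s ^ (k - j) * s ^ j"
    by (simp flip: power_add)
  then show "(s * x) ^ (k - j) * (s * u) ^ j / (fact (k - j) * fact (Suc j))
      = s ^ k * (x ^ (k - j) * u ^ j / (fact (k - j) * fact (Suc j)))"
    by (simp add: power_mult_distrib)
qed simp

section \<open>The exponential of a horizontal field\<close>

lemma equal_vector_derivatives_imp_equal:
  fixes f g :: "real \<Rightarrow> 'a::real_normed_vector"
  assumes f: "\<And>s. (f has_vector_derivative d s) (at s)"
    and g: "\<And>s. (g has_vector_derivative d s) (at s)"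
    and "f 0 = g 0"
  shows "f = g"
proof
  fix s
  have "((\<lambda>s. f s - g s) has_vector_derivative 0) (at s)" for s
    using has_vector_derivative_diff[OF f g] by simp
  then obtain c where "f s - g s = c" for s
    using has_vector_derivative_zero_constant[of UNIV "\<lambda>s. f s - g s"] by auto
  from this[of 0] this[of s] \<open>f 0 = g 0\<close> show "f s = g s"
    by simp
qed

text \<open>
  The system for an integral curve is triangular: the \<open>x\<close>-component satisfies \<open>x' = u\<close>, and once
  \<open>x\<close> is known the right-hand sides of the other equations are given functions of time. So
  integrating gives the curve explicitly, and two curves with the same start agree first in \<open>x\<close> and
  then in all components.
\<close>

lemma lie_exp_horizontal:
  "lie_exp (horizontal (u, v) :: 'p::{finite,linorder} filiform \<Rightarrow> _)
    = (u, v, \<chi> i. v * u ^ idx i / fact (Suc (idx i)))"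
proof -
  define c :: "real \<Rightarrow> 'p filiform"
    where "c s = (s * u, s * v, \<chi> i. s ^ Suc (idx i) * v * u ^ idx i / fact (Suc (idx i)))" for s
  have field: "horizontal (u, v) z = (u, v, \<chi> i. v * (fst z ^ idx i / fact (idx i)))"
    for z :: "'p filiform"
    by (cases z) (simp add: horizontal_def X_field_def Y_field_def vec_eq_iff)
  have c: "integral_curve (horizontal (u, v)) c"
    unfolding integral_curve_def
  proof
    fix s
    have "((\<lambda>s. \<chi> i. s ^ Suc (idx i) * v * u ^ idx i / fact (Suc (idx i))) has_vector_derivative
        (\<chi> i::'p. v * ((s * u) ^ idx i / fact (idx i)))) (at s)"
      unfolding has_vector_derivative_def has_derivative_componentwise_within[of "\<lambda>s. \<chi> i. _ s i"]
    proof
      fix b :: "(real, 'p) vec" assume "b \<in> Basis"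
      then obtain i where b: "b = axis i 1"
        by (auto simp: Basis_vec_def)
      have "((\<lambda>s. s ^ Suc (idx i) * v * u ^ idx i / fact (Suc (idx i))) has_real_derivative
          v * ((s * u) ^ idx i / fact (idx i))) (at s)"
        by (rule derivative_eq_intros refl | simp)+ (simp add: power_mult_distrib field_simps)
      then show "((\<lambda>s. (\<chi> i. s ^ Suc (idx i) * v * u ^ idx i / fact (Suc (idx i))) \<bullet> b) has_derivative
          (\<lambda>x. (x *\<^sub>R (\<chi> i. v * ((s * u) ^ idx i / fact (idx i)))) \<bullet> b)) (at s)"
        unfolding has_real_derivative_iff_has_vector_derivative has_vector_derivative_def
          b inner_axis vector_scaleR_component vec_lambda_beta
        by simp
    qed
    then show "(c has_vector_derivative horizontal (u, v) (c s)) (at s)"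
      unfolding c_def field fst_conv
      by (intro has_vector_derivative_Pair) (auto intro!: derivative_eq_intros)
  qed
  have c0: "c 0 = 0"
    by (simp add: c_def zero_prod_def vec_eq_iff)
  have unique: "g = c" if "integral_curve (horizontal (u, v)) g" "g 0 = 0" for g
  proof -
    have g: "(g has_vector_derivative horizontal (u, v) (g s)) (at s)" for s
      using that by (simp add: integral_curve_def)
    have c': "(c has_vector_derivative horizontal (u, v) (c s)) (at s)" for s
      using c by (simp add: integral_curve_def)
    have "(\<lambda>s. fst (g s)) = (\<lambda>s. fst (c s))"
    proof (rule equal_vector_derivatives_imp_equal)
      show "((\<lambda>s. fst (g s)) has_vector_derivative u) (at s)" for s
        using bounded_linear.has_vector_derivative[OF bounded_linear_fst g] by (simp add: field)
      show "((\<lambda>s. fst (c s)) has_vector_derivative u) (at s)" for s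
        using bounded_linear.has_vector_derivative[OF bounded_linear_fst c'] by (simp add: field)
      show "fst (g 0) = fst (c 0)"
        using that c0 by simp
    qed
    then have x: "fst (g s) = fst (c s)" for s
      by metis
    show "g = c"
    proof (rule equal_vector_derivatives_imp_equal[OF _ c'])
      show "(g has_vector_derivative horizontal (u, v) (c s)) (at s)" for s
        using g[of s] by (simp only: field x)
      show "g 0 = c 0"
        using that c0 by simp
    qed
  qed
  have "lie_exp (horizontal (u, v) :: 'p filiform \<Rightarrow> _) = c 1"
    unfolding lie_exp_def
  proof (rule the_equality)
    show "\<exists>\<gamma>. integral_curve (horizontal (u, v)) \<gamma> \<and> \<gamma> 0 = 0 \<and> \<gamma> 1 = c 1"
      using c c0 by (intro exI[of _ c] conjI) (simp_all only:)
    show "z = c 1" if "\<exists>\<gamma>. integral_curve (horizontal (u, v)) \<gamma> \<and> \<gamma> 0 = 0 \<and> \<gamma> 1 = z" for z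
      using that unique by metis
  qed
  then show ?thesis
    by (simp add: c_def)
qed

section \<open>A closed form for the multiexponential map\<close>

text \<open>
  The flow interpretation of the group law. In \<open>v\<close> times the mean, the term \<open>j = k\<close> is the
  \<open>t\<^sub>k\<close>-coordinate \<open>v u\<^sup>k / (k+1)!\<close> of the exponential, the term \<open>j = 0\<close> is the contribution
  \<open>x\<^sup>k \<eta> / k!\<close> with \<open>\<eta> = v\<close>, and the terms in between are the sum in the group law.
\<close>

lemma filiform_mult_lie_exp_horizontal:
  fixes t :: "real ^ 'p::{finite,linorder}"
  shows "(x, y, t) \<odot> lie_exp (horizontal (u, v))
    = (x + u, y + v, \<chi> i. t $ i + v * segment_mean (idx i) x u)"
proof -
  have "t $ i + v * u ^ idx i / fact (Suc (idx i)) + x ^ idx i / fact (idx i) * v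
      + (\<Sum>j\<in>{..<i}. x ^ (idx i - idx j) / fact (idx i - idx j) * (v * u ^ idx j / fact (Suc (idx j))))
      = t $ i + v * segment_mean (idx i) x u" for i :: 'p
  proof -
    let ?k = "idx i"
    let ?f = "\<lambda>j. x ^ (?k - j) * u ^ j / (fact (?k - j) * fact (Suc j))"
    have "(\<Sum>j\<in>{..<i}. x ^ (?k - idx j) / fact (?k - idx j) * (v * u ^ idx j / fact (Suc (idx j))))
        = v * (\<Sum>j\<in>{..<i}. ?f (idx j))"
      by (simp add: sum_distrib_left field_simps del: fact_Suc)
    also have "(\<Sum>j\<in>{..<i}. ?f (idx j)) = sum ?f (idx ` {..<i})"
      by (simp add: sum.reindex inj_on_idx)
    also have "\<dots> = sum ?f {1..<?k}"
      by (simp only: idx_image_lessThan)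
    finally have *: "(\<Sum>j\<in>{..<i}. x ^ (?k - idx j) / fact (?k - idx j) * (v * u ^ idx j / fact (Suc (idx j))))
        = v * sum ?f {1..<?k}" .
    have "{..?k} = insert 0 (insert ?k {1..<?k})"
      using idx_pos[of i] by auto
    then have "segment_mean ?k x u = ?f 0 + (?f ?k + sum ?f {1..<?k})"
      using idx_pos[of i] by (simp add: segment_mean_def)
    then show ?thesis
      unfolding * by (simp add: algebra_simps del: fact_Suc)
  qed
  note component = this
  show ?thesis
    unfolding filiform_mult_def lie_exp_horizontal
    by (simp only: prod.case) (simp only: vec_lambda_beta component)
qed

lemma multiexp_closed_form:
  "multiexp q w = (\<Sum>m<q. fst (w m), \<Sum>m<q. snd (w m),
     \<chi> i::'p::{finite,linorder}.
       \<Sum>m<q. snd (w m) * segment_mean (idx i) (\<Sum>l<m. fst (w l)) (fst (w m)))"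
proof (induction q)
  case 0
  then show ?case by (simp add: zero_prod_def vec_eq_iff)
next
  case (Suc q)
  have "multiexp (Suc q) w = (multiexp q w :: 'p filiform) \<odot> lie_exp (horizontal (fst (w q), snd (w q)))"
    by simp
  then show ?case
    unfolding Suc filiform_mult_lie_exp_horizontal by simp
qed

section \<open>Differentials on finite tuples\<close>

lemma tuples_bcontfun: "h \<in> tuples q \<Longrightarrow> h \<in> bcontfun"
proof -
  assume "h \<in> tuples q"
  then have "range h \<subseteq> insert 0 (h ` {..<q})"
    by (force simp: tuples_def not_le[symmetric])
  then have "bounded (range h)"
    by (meson finite_imageI finite_insert finite_imp_bounded finite_lessThan finite_subset)
  then show ?thesis by (simp add: bcontfun_def)
qed

lemma norm_Bcontfun_le_tuple_norm:
  assumes "h \<in> tuples q"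
  shows "norm (Bcontfun h) \<le> tuple_norm q h"
proof (rule norm_bound)
  fix i
  have "norm (h i) \<le> tuple_norm q h"
  proof (cases "i < q")
    case True
    then show ?thesis
      unfolding tuple_norm_def
      using member_le_L2_set[of "{..<q}" i "\<lambda>i. norm (h i)"] by simp
  next
    case False
    then show ?thesis
      using assms by (simp add: tuples_def tuple_norm_def)
  qed
  then show "norm (apply_bcontfun (Bcontfun h) i) \<le> tuple_norm q h"
    using assms by (simp add: Bcontfun_inverse tuples_bcontfun)
qed

text \<open>
  The spaces of \<open>q\<close>-tuples embed into one normed space of bounded sequences, where the calculus of
  Frechet derivatives applies. Bounded continuous functions on the discrete space of natural numbers
  serve as bounded sequences. The embedding does not increase norms, so the error estimate in the
  supremum norm implies the one in the Euclidean norm.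
\<close>

lemma has_differential_of_has_derivative:
  fixes F :: "(nat \<Rightarrow> 'e::euclidean_space) \<Rightarrow> 'b::real_normed_vector"
  assumes D: "((\<lambda>f. F (apply_bcontfun f)) has_derivative D) (at (Bcontfun w))"
    and w: "w \<in> tuples q"
  shows "has_differential q F (\<lambda>h. D (Bcontfun h)) w"
proof -
  interpret D: bounded_linear D
    using D by (rule has_derivative_bounded_linear)
  note inv = Bcontfun_inverse[OF tuples_bcontfun]
  have add: "Bcontfun (\<lambda>i. h i + k i) = Bcontfun h + Bcontfun k"
    if "h \<in> tuples q" "k \<in> tuples q" for h k :: "nat \<Rightarrow> 'e"
  proof -
    have "(\<lambda>i. h i + k i) \<in> tuples q"
      using that by (simp add: tuples_def)
    then show ?thesis
      using that by (intro bcontfun_eqI) (simp add: inv)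
  qed
  have scale: "Bcontfun (\<lambda>i. c *\<^sub>R h i) = c *\<^sub>R Bcontfun h" if "h \<in> tuples q" for c and h :: "nat \<Rightarrow> 'e"
  proof -
    have "(\<lambda>i. c *\<^sub>R h i) \<in> tuples q"
      using that by (simp add: tuples_def)
    then show ?thesis
      using that by (intro bcontfun_eqI) (simp add: inv)
  qed
  have small: "\<exists>d>0. \<forall>h\<in>tuples q. tuple_norm q h < d \<longrightarrow>
      norm (F (\<lambda>i. w i + h i) - F w - D (Bcontfun h)) \<le> e * tuple_norm q h" if "0 < e" for e
  proof -
    obtain d where "0 < d" and d: "\<And>f. norm (f - Bcontfun w) < d \<Longrightarrow>
        norm (F (apply_bcontfun f) - F (apply_bcontfun (Bcontfun w)) - D (f - Bcontfun w))
          \<le> e * norm (f - Bcontfun w)"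
      using D \<open>0 < e\<close> unfolding has_derivative_at_alt by blast
    have "norm (F (\<lambda>i. w i + h i) - F w - D (Bcontfun h)) \<le> e * tuple_norm q h"
      if "h \<in> tuples q" "tuple_norm q h < d" for h
    proof -
      have "norm (Bcontfun h) \<le> tuple_norm q h"
        using that(1) by (rule norm_Bcontfun_le_tuple_norm)
      moreover have "apply_bcontfun (Bcontfun w + Bcontfun h) = (\<lambda>i. w i + h i)"
        using w that by (auto simp: inv)
      ultimately show ?thesis
        using d[of "Bcontfun w + Bcontfun h"] that w \<open>0 < e\<close>
        by (simp add: inv) (meson less_eq_real_def mult_left_mono order_trans)
    qed
    then show ?thesis using \<open>0 < d\<close> by blast
  qed
  show ?thesis
    unfolding has_differential_def by (simp add: add scale D.add D.scaleR small)
qed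

text \<open>
  This determines the values of a differential, whichever one is given: they can be computed
  along lines, in one real variable.
\<close>

lemma has_differential_line_derivative:
  fixes F :: "(nat \<Rightarrow> 'e::euclidean_space) \<Rightarrow> 'b::real_normed_vector"
  assumes L: "has_differential q F L w" and h: "h \<in> tuples q"
  shows "((\<lambda>s. F (\<lambda>i. w i + s *\<^sub>R h i)) has_vector_derivative L h) (at 0)"
  unfolding has_vector_derivative_def has_derivative_at_alt
proof (intro conjI allI impI)
  show "bounded_linear (\<lambda>s. s *\<^sub>R L h)"
    by (rule bounded_linear_scaleR_left)
  fix e :: real assume "0 < e"
  \<comment> \<open>the summand \<open>1\<close> makes \<open>N\<close> a legitimate divisor also for \<open>h = 0\<close>\<close>
  define N where "N = tuple_norm q h + 1"
  have N: "0 < N" "tuple_norm q h \<le> N"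
    by (auto simp: N_def tuple_norm_def L2_set_nonneg add_nonneg_pos)
  obtain d where "0 < d" and d: "\<And>k. k \<in> tuples q \<Longrightarrow> tuple_norm q k < d \<Longrightarrow>
      norm (F (\<lambda>i. w i + k i) - F w - L k) \<le> e / N * tuple_norm q k"
    using L \<open>0 < e\<close> N unfolding has_differential_def by (metis divide_pos_pos)
  have "norm (F (\<lambda>i. w i + s *\<^sub>R h i) - F w - s *\<^sub>R L h) \<le> e * \<bar>s\<bar>" if "\<bar>s\<bar> < d / N" for s
  proof -
    have mem: "(\<lambda>i. s *\<^sub>R h i) \<in> tuples q"
      using h by (simp add: tuples_def)
    have "tuple_norm q (\<lambda>i. s *\<^sub>R h i) = \<bar>s\<bar> * tuple_norm q h"
      by (simp add: tuple_norm_def L2_set_right_distrib)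
    then have le: "tuple_norm q (\<lambda>i. s *\<^sub>R h i) \<le> \<bar>s\<bar> * N"
      using N by (simp add: mult_left_mono)
    also have "\<dots> < d"
      using that N by (simp add: field_simps)
    finally have "norm (F (\<lambda>i. w i + s *\<^sub>R h i) - F w - L (\<lambda>i. s *\<^sub>R h i))
        \<le> e / N * tuple_norm q (\<lambda>i. s *\<^sub>R h i)"
      by (rule d[OF mem])
    also have "\<dots> \<le> e / N * (\<bar>s\<bar> * N)"
      using le \<open>0 < e\<close> N by (intro mult_left_mono) auto
    also have "L (\<lambda>i. s *\<^sub>R h i) = s *\<^sub>R L h"
      using L h by (simp add: has_differential_def)
    finally show ?thesis
      using N by simp
  qed
  then show "\<exists>d>0. \<forall>y. norm (y - 0) < d \<longrightarrow>
      norm (F (\<lambda>i. w i + y *\<^sub>R h i) - F (\<lambda>i. w i + 0 *\<^sub>R h i) - (y - 0) *\<^sub>R L h) \<le> e * norm (y - 0)"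
    using \<open>0 < d\<close> N by (intro exI[of _ "d / N"]) simp
qed

section \<open>The differential of the multiexponential map\<close>

text \<open>
  By the closed form the multiexponential map is polynomial in the entries of the tuple.
\<close>

lemma multiexp_has_differential:
  assumes "w \<in> tuples q"
  shows "\<exists>L. has_differential q (multiexp q :: _ \<Rightarrow> 'p::{finite,linorder} filiform) L w"
proof -
  define W where "W = Bcontfun w"
  have coord: "(\<lambda>f. apply_bcontfun f m) differentiable (at W)" for m
    by (intro bounded_linear_imp_differentiable bounded_linear_intro[where K = 1])
      (simp_all add: norm_bounded)
  have x: "(\<lambda>f. fst (apply_bcontfun f m)) differentiable (at W)"
    and y: "(\<lambda>f. snd (apply_bcontfun f m)) differentiable (at W)" for m
    using differentiable_compose[OF bounded_linear_imp_differentiable[OF bounded_linear_fst] coord]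
      differentiable_compose[OF bounded_linear_imp_differentiable[OF bounded_linear_snd] coord]
    by simp_all
  have "(\<lambda>f. (\<chi> i::'p. \<Sum>m<q. snd (apply_bcontfun f m) *
        segment_mean (idx i) (\<Sum>l<m. fst (apply_bcontfun f l)) (fst (apply_bcontfun f m)))) differentiable (at W)"
    unfolding differentiable_componentwise_within[of "\<lambda>f. \<chi> i. _ f i"]
  proof
    fix b :: "(real, 'p) vec" assume "b \<in> Basis"
    then obtain i where b: "b = axis i 1"
      by (auto simp: Basis_vec_def)
    show "(\<lambda>f. (\<chi> i. \<Sum>m<q. snd (apply_bcontfun f m) * segment_mean (idx i)
        (\<Sum>l<m. fst (apply_bcontfun f l)) (fst (apply_bcontfun f m))) \<bullet> b) differentiable (at W)"
      unfolding b segment_mean_def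
      by (simp add: inner_axis, intro derivative_intros ballI x y) (simp_all del: fact_Suc)
  qed
  then have "(\<lambda>f. multiexp q (apply_bcontfun f) :: 'p filiform) differentiable (at W)"
    unfolding multiexp_closed_form by (intro derivative_intros ballI x y) simp_all
  then show ?thesis
    unfolding W_def differentiable_def
    using has_differential_of_has_derivative assms by blast
qed

lemma subspace_image_has_differential:
  assumes "has_differential q F L w"
  shows "subspace (L ` tuples q)"
proof (rule subspaceI)
  have add: "L (\<lambda>i. h i + k i) = L h + L k" if "h \<in> tuples q" "k \<in> tuples q" for h k
    using assms that by (simp add: has_differential_def)
  have scale: "L (\<lambda>i. c *\<^sub>R h i) = c *\<^sub>R L h" if "h \<in> tuples q" for c h
    using assms that by (simp add: has_differential_def)
  have "(\<lambda>i. 0) \<in> tuples q"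
    by (simp add: tuples_def)
  with scale[of "\<lambda>i. 0" 0] show "0 \<in> L ` tuples q"
    by (auto intro: rev_image_eqI)
  show "x + y \<in> L ` tuples q" if "x \<in> L ` tuples q" "y \<in> L ` tuples q" for x y
    using that by (auto simp: tuples_def simp flip: add intro!: imageI)
  show "c *\<^sub>R x \<in> L ` tuples q" if "x \<in> L ` tuples q" for c x
    using that by (auto simp: tuples_def simp flip: scale intro!: imageI)
qed

text \<open>
  For \<open>u = 0\<close> the unperturbed path stays over \<open>x = 0\<close>, where \<open>z\<^sup>k / k!\<close> vanishes to second order
  as soon as \<open>k \<ge> 2\<close>; hence \<open>t\<^sub>k\<close> is stationary there.
\<close>

lemma multiexp_not_submersive_at_vertical:
  assumes p: "CARD('p::{finite,linorder}) \<ge> 2"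
    and L: "has_differential q (multiexp q :: _ \<Rightarrow> 'p filiform) L (diagonal_tuple q (0, v))"
  shows "L ` tuples q \<noteq> UNIV"
proof -
  \<comment> \<open>the largest index \<open>i\<close> stands for \<open>t\<^sub>p\<close>, and \<open>p \<ge> 2\<close>\<close>
  obtain i :: 'p where i: "2 \<le> idx i"
  proof -
    have "{..Max (UNIV :: 'p set)} = UNIV" by auto
    then have "idx (Max (UNIV :: 'p set)) = CARD('p)" by (simp add: idx_def)
    with p that show thesis by metis
  qed
  have "snd (snd (L h)) $ i = 0" if h: "h \<in> tuples q" for h
  proof -
    define C where "C = (\<lambda>s. \<Sum>m<q. (v + s * snd (h m)) * segment_mean (idx i) (\<Sum>l<m. fst (h l)) (fst (h m)))"
    have "snd (snd (multiexp q (\<lambda>m. diagonal_tuple q (0, v) m + s *\<^sub>R h m))) $ i = s ^ idx i * C s" for s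
    proof -
      have "snd (snd (multiexp q (\<lambda>m. diagonal_tuple q (0, v) m + s *\<^sub>R h m))) $ i
          = (\<Sum>m<q. (v + s * snd (h m)) * segment_mean (idx i) (\<Sum>l<m. s * fst (h l)) (s * fst (h m)))"
        unfolding multiexp_closed_form by (simp add: diagonal_tuple_def)
      also have "\<dots> = (\<Sum>m<q. s ^ idx i *
          ((v + s * snd (h m)) * segment_mean (idx i) (\<Sum>l<m. fst (h l)) (fst (h m))))"
        by (simp only: sum_distrib_left[symmetric] segment_mean_scale mult.left_commute)
      finally show ?thesis
        by (simp add: C_def sum_distrib_left)
    qed
    moreover have "((\<lambda>s. snd (snd (multiexp q (\<lambda>m. diagonal_tuple q (0, v) m + s *\<^sub>R h m))) $ i)
        has_vector_derivative snd (snd (L h)) $ i) (at 0)"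
      by (intro bounded_linear.has_vector_derivative[OF bounded_linear_vec_nth]
          bounded_linear.has_vector_derivative[OF bounded_linear_snd]
          has_differential_line_derivative[OF L h])
    ultimately have 1: "((\<lambda>s. s ^ idx i * C s) has_vector_derivative snd (snd (L h)) $ i) (at 0)"
      by simp
    have "C differentiable at 0"
      unfolding C_def by (intro derivative_intros ballI) auto
    then obtain C' where "(C has_real_derivative C') (at 0)"
      by (auto simp: real_differentiable_def)
    then have "((\<lambda>s. s ^ idx i * C s) has_real_derivative 0) (at 0)"
      using i by (auto intro!: derivative_eq_intros simp: power_0_left)
    with 1 show ?thesis
      by (simp add: has_real_derivative_iff_has_vector_derivative vector_derivative_unique_at)
  qed
  moreover have "snd (snd ((0, 0, axis i 1) :: 'p filiform)) $ i \<noteq> 0"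
    by simp
  ultimately show ?thesis
    by (metis UNIV_I imageE)
qed

text \<open>
  The relation says that the polynomial \<open>P(z) = b z + \<Sum>\<^sub>k c\<^sub>k z\<^sup>k\<^sup>+\<^sup>1 / (k+1)!\<close> has increment zero over
  each of \<open>p + 1\<close> consecutive segments of length \<open>|u|\<close>. As \<open>P 0 = 0\<close>, all \<open>p + 2\<close> endpoints are
  roots, while the degree is at most \<open>p + 1\<close>.
\<close>

lemma segment_mean_independent:
  fixes c :: "real ^ 'p::{finite,linorder}"
  assumes "u \<noteq> 0"
    and zero: "\<And>j. j < Suc (CARD('p)) \<Longrightarrow> b + (\<Sum>i\<in>UNIV. c $ i * segment_mean (idx i) (real j * u) u) = 0"
  shows "b = 0" "c = 0"
proof -
  define P where "P = monom b 1 + (\<Sum>i\<in>UNIV. monom (c $ i / fact (Suc (idx i))) (Suc (idx i)))"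
  have P: "poly P z = b * z + (\<Sum>i\<in>UNIV. c $ i * (z ^ Suc (idx i) / fact (Suc (idx i))))" for z
    by (simp add: P_def poly_sum poly_monom del: fact_Suc)
  have step: "poly P (real (Suc j) * u) = poly P (real j * u)" if "j < Suc (CARD('p))" for j
  proof -
    have "poly P (real (Suc j) * u) - poly P (real j * u)
        = b * u + (\<Sum>i\<in>UNIV. c $ i * (((real j * u + u) ^ Suc (idx i) - (real j * u) ^ Suc (idx i)) / fact (Suc (idx i))))"
      unfolding P by (simp add: algebra_simps diff_divide_distrib sum_subtractf del: fact_Suc power_Suc)
    also have "\<dots> = u * (b + (\<Sum>i\<in>UNIV. c $ i * segment_mean (idx i) (real j * u) u))"
      unfolding segment_mean_telescope[symmetric] by (simp add: algebra_simps sum_distrib_left)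
    finally show ?thesis using zero[OF that] by simp
  qed
  have root: "poly P (real j * u) = 0" if "j \<le> Suc (CARD('p))" for j
    using that
  proof (induction j)
    case 0
    then show ?case by (simp add: P)
  next
    case (Suc j)
    then show ?case using step[of j] by simp
  qed
  have deg: "degree P \<le> Suc (CARD('p))"
    unfolding P_def using idx_le_CARD
    by (auto intro!: degree_add_le degree_sum_le order_trans[OF degree_monom_le])
  have "P = 0"
  proof (rule ccontr)
    assume "P \<noteq> 0"
    have "inj_on (\<lambda>j. real j * u) {..Suc (CARD('p))}"
      using \<open>u \<noteq> 0\<close> by (auto simp: inj_on_def)
    then have "Suc (Suc (CARD('p))) = card ((\<lambda>j. real j * u) ` {..Suc (CARD('p))})"
      by (simp add: card_image)
    also have "\<dots> \<le> card {z. poly P z = 0}"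
      using root \<open>P \<noteq> 0\<close> by (intro card_mono poly_roots_finite) auto
    also have "\<dots> \<le> degree P"
      using \<open>P \<noteq> 0\<close> by (rule card_poly_roots_bound)
    finally show False using deg by simp
  qed
  moreover have "coeff P 1 = b"
    by (simp add: P_def coeff_sum idx_pos[THEN less_imp_neq, THEN not_sym] del: fact_Suc)
  moreover have "coeff P (Suc (idx k)) = c $ k / fact (Suc (idx k))" for k
  proof -
    have "idx i = idx k \<longleftrightarrow> i = k" for i
      by (rule strict_mono_eq[OF strict_mono_idx])
    then show ?thesis
      using idx_pos[of k] by (simp add: P_def coeff_sum del: fact_Suc)
  qed
  ultimately show "b = 0" "c = 0"
    by (auto simp: vec_eq_iff simp del: fact_Suc)
qed

text \<open>
  A vector orthogonal to the image annihilates the derivatives in the directions \<open>v\<^sub>j\<close>. The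
  independence of the segment means leaves only its \<open>x\<close>-component, which is killed by a direction
  that moves \<open>x\<close>.
\<close>

lemma multiexp_submersive_if_not_vertical:
  assumes "u \<noteq> 0"
    and L: "has_differential (Suc (CARD('p))) (multiexp (Suc (CARD('p))) :: _ \<Rightarrow> 'p::{finite,linorder} filiform) L
        (diagonal_tuple (Suc (CARD('p))) (u, v))"
  shows "L ` tuples (Suc (CARD('p))) = UNIV"
proof (rule ccontr)
  let ?q = "Suc (CARD('p))"
  let ?w = "diagonal_tuple ?q (u, v)"
  \<comment> \<open>\<open>e j\<close> varies \<open>v\<^sub>j\<close> alone and leaves all abscissae in place; \<open>f\<close> varies \<open>u\<^sub>0\<close> alone\<close>
  define e :: "nat \<Rightarrow> nat \<Rightarrow> real \<times> real" where "e j = (\<lambda>i. if i = j then (0, 1) else 0)" for j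
  define f :: "nat \<Rightarrow> real \<times> real" where "f = (\<lambda>i. if i = 0 then (1, 0) else 0)"
  have e: "e j \<in> tuples ?q" if "j < ?q" for j
    using that by (auto simp: tuples_def e_def)
  have f: "f \<in> tuples ?q"
    by (auto simp: tuples_def f_def)
  have Le: "L (e j) = (0, 1, \<chi> i. segment_mean (idx i) (real j * u) u)" (is "_ = ?d") if "j < ?q" for j
  proof -
    have "multiexp ?q (\<lambda>i. ?w i + s *\<^sub>R e j i) = multiexp ?q ?w + s *\<^sub>R ?d" for s
    proof -
      have fst: "fst (?w m + s *\<^sub>R e j m) = fst (?w m)" for m
        by (simp add: e_def)
      have snd: "snd (?w m + s *\<^sub>R e j m) = snd (?w m) + (if m = j then s else 0)" for m
        by (simp add: e_def)
      have "segment_mean k (\<Sum>l<j. fst (?w l)) (fst (?w j)) = segment_mean k (real j * u) u" for k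
        using that by (simp add: diagonal_tuple_def)
      then show ?thesis
        unfolding multiexp_closed_form fst snd using that
        by (simp add: sum.distrib vec_eq_iff algebra_simps if_distrib[of "\<lambda>x. x * _"]
            del: sum.lessThan_Suc cong: if_cong)
    qed
    moreover have "((\<lambda>s. multiexp ?q ?w + s *\<^sub>R ?d) has_vector_derivative ?d) (at 0)"
      by (auto intro!: derivative_eq_intros)
    ultimately show ?thesis
      using has_differential_line_derivative[OF L e[OF that]]
      by (simp add: vector_derivative_unique_at)
  qed
  have Lf: "fst (L f) = 1"
  proof -
    have "fst (multiexp ?q (\<lambda>i. ?w i + s *\<^sub>R f i)) = real ?q * u + s" for s
      unfolding multiexp_closed_form
      by (simp add: f_def diagonal_tuple_def sum.distrib if_distrib[of fst] if_distrib[of "\<lambda>x. s *\<^sub>R x"]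
          del: sum.lessThan_Suc cong: if_cong)
    then have eq: "(\<lambda>s. fst (multiexp ?q (\<lambda>i. ?w i + s *\<^sub>R f i))) = (\<lambda>s. real ?q * u + s)"
      by blast
    have "((\<lambda>s. real ?q * u + s) has_vector_derivative fst (L f)) (at 0)"
      using bounded_linear.has_vector_derivative[OF bounded_linear_fst
          has_differential_line_derivative[OF L f]] unfolding eq .
    moreover have "((\<lambda>s. real ?q * u + s) has_vector_derivative 1) (at 0)"
      by (auto intro!: derivative_eq_intros)
    ultimately show ?thesis
      by (rule vector_derivative_unique_at)
  qed
  assume "L ` tuples ?q \<noteq> UNIV"
  moreover have "subspace (L ` tuples ?q)"
    using L by (rule subspace_image_has_differential)
  ultimately have "span (L ` tuples ?q) \<noteq> UNIV"
    by (metis span_eq_iff)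
  then obtain g where "g \<noteq> 0" and g: "\<And>z. z \<in> L ` tuples ?q \<Longrightarrow> g \<bullet> z = 0"
    using span_not_UNIV_orthogonal span_base by (metis (no_types, lifting))
  obtain a b c where abc: "g = (a, b, c)"
    by (metis surj_pair)
  have "b + (\<Sum>i\<in>UNIV. c $ i * segment_mean (idx i) (real j * u) u) = 0" if "j < ?q" for j
    using g[OF imageI, OF e[OF that]] by (simp add: Le[OF that] abc inner_vec_def)
  from segment_mean_independent[OF \<open>u \<noteq> 0\<close> this] have "b = 0" "c = 0"
    by auto
  moreover have "a = 0"
    using g[OF imageI, OF f] Lf calculation by (simp add: abc inner_prod_def)
  ultimately show False
    using \<open>g \<noteq> 0\<close> by (simp add: abc zero_prod_def)
qed

theorem theorem1p2:
  fixes u v :: real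
  assumes "CARD('p::{finite,linorder}) \<ge> 2"
  shows "(\<exists>q\<ge>1. \<exists>L. has_differential q (multiexp q :: (nat \<Rightarrow> real \<times> real) \<Rightarrow> 'p filiform) L
              (diagonal_tuple q (u, v))
            \<and> L ` tuples q = UNIV)
         \<longleftrightarrow> u \<noteq> 0"
proof
  assume "u \<noteq> 0"
  have "diagonal_tuple (Suc (CARD('p))) (u, v) \<in> tuples (Suc (CARD('p)))"
    by (simp add: tuples_def diagonal_tuple_def)
  with multiexp_has_differential multiexp_submersive_if_not_vertical[OF \<open>u \<noteq> 0\<close>]
  show "\<exists>q\<ge>1. \<exists>L. has_differential q (multiexp q :: (nat \<Rightarrow> real \<times> real) \<Rightarrow> 'p filiform) L
      (diagonal_tuple q (u, v)) \<and> L ` tuples q = UNIV"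
    by (metis Suc_le_eq One_nat_def zero_less_Suc)
qed (use multiexp_not_submersive_at_vertical[OF assms] in blast)

end
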